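(* For every integer $n\geq 7$, the symmetric-maximizer conjecture fails in order $n$; that is, there exists a matrix $A\in\mathbb{R}^{n\times n}$ such that $$\|\mathcal{L}_A|_{\mathbb{K}_n}\|>\|\mathcal{L}_A|_{\mathbb{S}_n}\|.$$
   Context: For $A\in\mathbb{R}^{n\times n}$, the Lyapunov operator is the linear map $\mathcal{L}_A:\mathbb{R}^{n\times n}\to\mathbb{R}^{n\times n}$, $\mathcal{L}_A(X)=AX+XA^\top$. The space $\mathbb{R}^{n\times n}$ carries the Frobenius inner product $\langle X,Y\rangle_F=\operatorname{tr}(X^\top Y)$ and norm $\|X\|_F=\langle X,X\rangle_F^{1/2}$. Let $\mathbb{S}_n=\{X\in\mathbb{R}^{n\times n}:X^\top=X\}$ and $\mathbb{K}_n=\{X\in\mathbb{R}^{n\times n}:X^\top=-X\}$; both subspaces are invariant under $\mathcal{L}_A$. For $\mathbb{U}\in\{\mathbb{S}_n,\mathbb{K}_n\}$, the restricted operator norm is $$\|\mathcal{L}_A|_{\mathbb{U}}\|=\max_{0\ne X\in\mathbb{U}}\frac{\|AX+XA^\top\|_F}{\|X\|_F}.$$ The symmetric-maximizer conjecture in order $n$ is the statement that $\|\mathcal{L}_A|_{\mathbb{K}_n}\|\leq\|\mathcal{L}_A|_{\mathbb{S}_n}\|$ for every $A\in\mathbb{R}^{n\times n}$; equivalently, that for every such $A$ the maximum of $\|AX+XA^\top\|_F/\|X\|_F$ over all nonzero $X\in\mathbb{R}^{n\times n}$ is attained at a symmetric matrix. *)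

theory Defs
  imports "HOL-Analysis.Analysis"
begin

definition frob_inner :: "real^'n^'n \<Rightarrow> real^'n^'n \<Rightarrow> real" where
  "frob_inner X Y = trace (transpose X ** Y)"

definition frob_norm :: "real^'n^'n \<Rightarrow> real" where
  "frob_norm X = sqrt (frob_inner X X)"

lemma frob_inner_eq_inner: "frob_inner X Y = inner X Y"
  unfolding frob_inner_def trace_def matrix_matrix_mult_def transpose_def inner_vec_def
  by simp (rule sum.swap)

lemma frob_norm_eq_norm: "frob_norm X = norm X"
  by (simp add: frob_norm_def frob_inner_eq_inner norm_eq_sqrt_inner)

definition lyapunov :: "real^'n^'n \<Rightarrow> real^'n^'n \<Rightarrow> real^'n^'n" where
  "lyapunov A X = A ** X + X ** transpose A"

lemma linear_lyapunov: "linear (lyapunov A)"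
  by (rule linearI)
     (simp_all add: lyapunov_def matrix_matrix_mult_def transpose_def vec_eq_iff
        distrib_left distrib_right sum.distrib sum_distrib_left mult.left_commute mult.assoc)

definition sym_matrices :: "(real^'n^'n) set" where
  "sym_matrices = {X. transpose X = X}"

definition skew_matrices :: "(real^'n^'n) set" where
  "skew_matrices = {X. transpose X = - X}"

lemma subspace_sym_matrices: "subspace (sym_matrices :: (real^'n^'n) set)"
  by (simp add: subspace_def sym_matrices_def transpose_def vec_eq_iff)

lemma subspace_skew_matrices: "subspace (skew_matrices :: (real^'n^'n) set)"
proof -
  have "transpose (X + Y) = transpose X + transpose Y"
       "transpose (c *\<^sub>R X) = c *\<^sub>R transpose X"
       "transpose (0 :: real^'n^'n) = 0" for X Y :: "real^'n^'n" and c
    by (simp_all add: transpose_def vec_eq_iff)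
  then show ?thesis
    by (simp add: subspace_def skew_matrices_def)
qed

text \<open>The supremum below is a maximum whenever \<open>U\<close> is a nonzero subspace and \<open>L\<close> is linear;
  see \<open>restr_norm_attained\<close>. On the zero subspace the value is unspecified.\<close>

definition restr_norm :: "(real^'n^'n \<Rightarrow> real^'n^'n) \<Rightarrow> (real^'n^'n) set \<Rightarrow> real" where
  "restr_norm L U = (SUP X\<in>U - {0}. frob_norm (L X) / frob_norm X)"

lemma restr_norm_attained:
  fixes L :: "real^'n^'n \<Rightarrow> real^'n^'n"
  assumes L: "linear L" and U: "subspace U" and ne: "U \<noteq> {0}"
  shows "\<exists>X\<in>U - {0}. restr_norm L U = frob_norm (L X) / frob_norm X \<and>
           (\<forall>Y\<in>U - {0}. frob_norm (L Y) / frob_norm Y \<le> frob_norm (L X) / frob_norm X)"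
proof -
  let ?S = "U \<inter> sphere 0 1"
  obtain Z where Z: "Z \<in> U" "Z \<noteq> 0"
    using ne subspace_0[OF U] by auto
  have "(1 / norm Z) *\<^sub>R Z \<in> ?S"
    using Z by (simp add: subspace_scale[OF U])
  then have "?S \<noteq> {}" by blast
  moreover have "compact ?S"
    by (simp add: closed_Int_compact closed_subspace U)
  moreover have "continuous_on ?S (\<lambda>X. norm (L X))"
    by (rule continuous_on_norm[OF linear_continuous_on[OF linear_conv_bounded_linear[THEN iffD1, OF L]]])
  ultimately obtain X where X: "X \<in> ?S" and max: "\<And>Y. Y \<in> ?S \<Longrightarrow> norm (L Y) \<le> norm (L X)"
    using continuous_attains_sup[of ?S "\<lambda>X. norm (L X)"] by blast
  have X0: "X \<in> U - {0}" and nX: "norm X = 1" using X by auto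
  have le: "frob_norm (L Y) / frob_norm Y \<le> frob_norm (L X) / frob_norm X" if "Y \<in> U - {0}" for Y
  proof -
    have "(1 / norm Y) *\<^sub>R Y \<in> ?S"
      using that by (simp add: subspace_scale[OF U])
    from max[OF this] show ?thesis
      by (simp add: frob_norm_eq_norm linear_cmul[OF L] nX)
  qed
  have "restr_norm L U = frob_norm (L X) / frob_norm X"
    unfolding restr_norm_def using X0 le by (intro cSup_eq_maximum) auto
  with X0 le show ?thesis by (intro bexI[of _ X]) simp_all
qed

definition symmetric_maximizer_conjecture :: "'n::finite itself \<Rightarrow> bool" where
  "symmetric_maximizer_conjecture (_ :: 'n itself) \<longleftrightarrow>
     (\<forall>A :: real^'n^'n.
        restr_norm (lyapunov A) skew_matrices \<le> restr_norm (lyapunov A) sym_matrices)"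

end

theory Submission
  imports Defs
begin

text \<open>
  The counterexample starts from a tie. Let \<open>A\<close> be block diagonal with blocks \<open>A1\<close> of order 3 and
  \<open>A2\<close> of order 4. An off-diagonal block \<open>P\<close> sits in the symmetric matrix \<open>(0, P; P\<^sup>T, 0)\<close> and in the
  skew matrix \<open>(0, P; -P\<^sup>T, 0)\<close>, and \<open>L\<^sub>A\<close> stretches both by the same factor. Take
  \<^item> \<open>A1\<close>: \<open>e0 \<mapsto> 20 e1\<close>, \<open>e1 \<mapsto> 3 e2\<close>, \<open>e2 \<mapsto> 14 e2\<close>,
  \<^item> \<open>A2\<close>: \<open>e3 \<mapsto> 13 e3 + 5 e4\<close>, \<open>e4 \<mapsto> 17 e5\<close>, \<open>e5 \<mapsto> 16 e6\<close>, \<open>e6 \<mapsto> 0\<close>.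

  Here the off-diagonal block is what attains the norm, on symmetric as well as on skew matrices: the
  squared factor is about 867.2, against about 848.4 and 850.0 on the symmetric diagonal blocks and
  less than 742 on the skew ones. Now add the small couplings \<open>e3 \<mapsto> 3 e0\<close> and \<open>e5 \<mapsto> -e2\<close>.
  They let the maximiser leak into the diagonal blocks, and this leakage is symmetric in one case and
  skew in the other, so the two norms part: the squared norm grows to about 878.1 on skew
  matrices but only to about 874.7 on symmetric ones. The number 877 separates the two values.

  The skew side is witnessed by one integer matrix (\<open>skew_gain\<close>). On the symmetric side the form
  \<open>877 \<parallel>X\<parallel>\<^sup>2 - \<parallel>AX + XA\<^sup>T\<parallel>\<^sup>2\<close> in the 28 entries of \<open>X\<close> is a sum of nonnegative forms
  (\<open>sym_bound\<close>); because \<open>A\<close> is sparse, so is its elimination.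

  For larger order, \<open>A\<close> is extended by zero. A symmetric matrix then has new columns \<open>v\<close> beside the
  corner, and they are mapped to \<open>Av\<close>, hence stretched by at most the spectral norm of \<open>A\<close>. That is
  harmless: rank-one matrices \<open>v v\<^sup>T\<close> show that even twice the squared spectral norm is at
  most the squared symmetric norm of the corner (\<open>rank_one_bound\<close>).
\<close>

section \<open>Extension by zero\<close>

text \<open>The entry \<open>(k, l)\<close> of \<open>ax + xa\<^sup>T\<close>. Corner matrices are functions on \<open>nat\<close>, so that a corner of
  fixed size can be written out entry by entry inside a matrix indexed by an arbitrary finite type.\<close>

definition lyap_entry :: "nat \<Rightarrow> (nat \<Rightarrow> nat \<Rightarrow> real) \<Rightarrow> (nat \<Rightarrow> nat \<Rightarrow> real) \<Rightarrow> nat \<Rightarrow> nat \<Rightarrow> real" where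
  "lyap_entry m a x k l = (\<Sum>i<m. a k i * x i l) + (\<Sum>i<m. x k i * a l i)"

definition pad :: "nat \<Rightarrow> (nat \<Rightarrow> 'n) \<Rightarrow> (nat \<Rightarrow> nat \<Rightarrow> real) \<Rightarrow> real^'n^'n" where
  "pad m e a = (\<chi> i j. if i \<in> e ` {..<m} \<and> j \<in> e ` {..<m}
     then a (inv_into {..<m} e i) (inv_into {..<m} e j) else 0)"

lemma pad_entry:
  assumes "inj_on e {..<m}" "k < m" "l < m"
  shows "pad m e a $ e k $ e l = a k l"
  using assms by (simp add: pad_def)

lemma pad_outside: "i \<notin> e ` {..<m} \<or> j \<notin> e ` {..<m} \<Longrightarrow> pad m e a $ i $ j = 0"
  by (auto simp: pad_def)

lemma sum_UNIV_supported:
  fixes f :: "'n::finite \<Rightarrow> real"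
  assumes "inj_on e {..<m}" "\<And>i. i \<notin> e ` {..<m} \<Longrightarrow> f i = 0"
  shows "(\<Sum>i\<in>UNIV. f i) = (\<Sum>k<m. f (e k))"
proof -
  have "(\<Sum>i\<in>UNIV. f i) = (\<Sum>i\<in>e ` {..<m}. f i)"
    by (rule sum.mono_neutral_right) (use assms(2) in auto)
  also have "\<dots> = (\<Sum>k<m. f (e k))"
    using assms(1) by (simp add: sum.reindex)
  finally show ?thesis .
qed

lemma power2_norm_matrix: "(norm X)\<^sup>2 = (\<Sum>i\<in>UNIV. \<Sum>j\<in>UNIV. (X $ i $ j)\<^sup>2)"
  for X :: "real^'n^'n"
  unfolding power2_norm_eq_inner inner_vec_def by (simp add: power2_eq_square)

lemma pad_mult_entry:
  fixes e :: "nat \<Rightarrow> 'n::finite"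
  assumes "inj_on e {..<m}" "k < m"
  shows "(pad m e a ** X) $ e k $ j = (\<Sum>l<m. a k l * X $ e l $ j)"
proof -
  have "(pad m e a ** X) $ e k $ j = (\<Sum>i\<in>UNIV. pad m e a $ e k $ i * X $ i $ j)"
    by (simp add: matrix_matrix_mult_def)
  also have "\<dots> = (\<Sum>l<m. pad m e a $ e k $ e l * X $ e l $ j)"
    using assms(1) by (rule sum_UNIV_supported) (simp add: pad_outside)
  finally show ?thesis using assms by (simp add: pad_entry)
qed

lemma pad_mult_outside: "i \<notin> e ` {..<m} \<Longrightarrow> (pad m e a ** X) $ i $ j = 0"
  for e :: "nat \<Rightarrow> 'n::finite"
  by (simp add: matrix_matrix_mult_def pad_outside)

lemma lyapunov_entry: "lyapunov A X $ i $ j = (A ** X) $ i $ j + (A ** transpose X) $ j $ i"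
  by (simp add: lyapunov_def matrix_matrix_mult_def transpose_def mult.commute)

lemma lyapunov_pad_entry:
  fixes e :: "nat \<Rightarrow> 'n::finite"
  assumes "inj_on e {..<m}" "k < m" "l < m"
  shows "lyapunov (pad m e a) X $ e k $ e l = lyap_entry m a (\<lambda>p q. X $ e p $ e q) k l"
  using assms by (simp add: lyapunov_entry pad_mult_entry lyap_entry_def transpose_def mult.commute)

text \<open>A bound for the symmetric norm controls the spectral norm: for \<open>x = v v\<^sup>T\<close> and \<open>u = a v\<close> the image
  is \<open>u v\<^sup>T + v u\<^sup>T\<close>, of squared norm \<open>2 |u|\<^sup>2 |v|\<^sup>2 + 2 (u \<bullet> v)\<^sup>2\<close>.\<close>

lemma rank_one_bound:
  assumes bound: "\<And>x. (\<And>k l. x k l = x l k) \<Longrightarrow>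
      (\<Sum>k<m. \<Sum>l<m. (lyap_entry m a x k l)\<^sup>2) \<le> c * (\<Sum>k<m. \<Sum>l<m. (x k l)\<^sup>2)"
  shows "2 * (\<Sum>k<m. (\<Sum>l<m. a k l * v l)\<^sup>2) \<le> c * (\<Sum>l<m. (v l)\<^sup>2)"
proof -
  define u where "u k = (\<Sum>l<m. a k l * v l)" for k
  define s where "s = (\<Sum>l<m. (v l)\<^sup>2)"
  define t where "t = (\<Sum>k<m. (u k)\<^sup>2)"
  define d where "d = (\<Sum>k<m. u k * v k)"
  have entry: "lyap_entry m a (\<lambda>k l. v k * v l) k l = u k * v l + v k * u l" for k l
    by (simp add: lyap_entry_def u_def sum_distrib_left sum_distrib_right algebra_simps)
  have "(\<Sum>k<m. \<Sum>l<m. (u k * v l + v k * u l)\<^sup>2) =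
      (\<Sum>k<m. \<Sum>l<m. (u k)\<^sup>2 * (v l)\<^sup>2) + (\<Sum>k<m. \<Sum>l<m. (v k)\<^sup>2 * (u l)\<^sup>2)
      + 2 * (\<Sum>k<m. \<Sum>l<m. (u k * v k) * (u l * v l))"
    by (simp add: sum.distrib sum_distrib_left power2_eq_square algebra_simps)
  also have "\<dots> = 2 * t * s + 2 * d\<^sup>2"
    by (simp add: s_def t_def d_def power2_eq_square[of "sum _ _"] sum_product[symmetric])
  finally have F: "(\<Sum>k<m. \<Sum>l<m. (lyap_entry m a (\<lambda>k l. v k * v l) k l)\<^sup>2) = 2 * t * s + 2 * d\<^sup>2"
    by (simp add: entry)
  have q: "(\<Sum>k<m. \<Sum>l<m. (v k * v l)\<^sup>2) = s * s"
    by (simp add: s_def power_mult_distrib sum_product)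
  have "2 * t * s + 2 * d\<^sup>2 \<le> c * (s * s)"
    using bound[of "\<lambda>k l. v k * v l"] by (simp add: F q mult.commute)
  then have le: "(2 * t) * s \<le> (c * s) * s"
    by (smt (verit) mult.assoc zero_le_power2)
  show ?thesis
  proof (cases "s = 0")
    case True
    then have "\<forall>l<m. v l = 0"
      by (simp add: s_def sum_nonneg_eq_0_iff)
    then have "t = 0"
      by (simp add: t_def u_def)
    with True show ?thesis by (simp add: s_def t_def u_def)
  next
    case False
    then have "s > 0" by (simp add: s_def order_less_le sum_nonneg)
    with le have "2 * t \<le> c * s" by simp
    then show ?thesis by (simp add: s_def t_def u_def)
  qed
qed

text \<open>Extension by zero does not increase the symmetric norm. The entries outside the corner
  decouple: those in a column \<open>j\<close> next to the corner are acted on by \<open>a\<close> alone, and occur twice by symmetry.\<close>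

lemma norm_lyapunov_pad_sym_le:
  fixes e :: "nat \<Rightarrow> 'n::finite"
  assumes inj: "inj_on e {..<m}" and "0 \<le> c"
    and bound: "\<And>x. (\<And>k l. x k l = x l k) \<Longrightarrow>
      (\<Sum>k<m. \<Sum>l<m. (lyap_entry m a x k l)\<^sup>2) \<le> c * (\<Sum>k<m. \<Sum>l<m. (x k l)\<^sup>2)"
    and X: "X \<in> sym_matrices"
  shows "(norm (lyapunov (pad m e a) X))\<^sup>2 \<le> c * (norm X)\<^sup>2"
proof -
  define I where "I = e ` {..<m}"
  define P where "P = pad m e a ** X"
  have tX: "transpose X = X" using X by (simp add: sym_matrices_def)
  have symX: "X $ i $ j = X $ j $ i" for i j
    using tX by (metis transpose_def vec_lambda_beta)
  have split: "(\<Sum>i\<in>UNIV. \<Sum>j\<in>UNIV. f i j) =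
      (\<Sum>i\<in>I. \<Sum>j\<in>I. f i j) + (\<Sum>j\<in>-I. \<Sum>i\<in>I. f i j) + (\<Sum>i\<in>-I. \<Sum>j\<in>I. f i j) + (\<Sum>i\<in>-I. \<Sum>j\<in>-I. f i j)"
    for f :: "'n \<Rightarrow> 'n \<Rightarrow> real"
  proof -
    have *: "(\<Sum>i\<in>UNIV. g i) = (\<Sum>i\<in>I. g i) + (\<Sum>i\<in>-I. g i)" for g :: "'n \<Rightarrow> real"
      by (metis Compl_eq_Diff_UNIV add.commute finite sum.subset_diff subset_UNIV)
    show ?thesis
      by (subst sum.swap[of _ I "-I"]) (simp add: * sum.distrib)
  qed
  have L: "lyapunov (pad m e a) X $ i $ j = P $ i $ j + P $ j $ i" for i j
    by (simp add: lyapunov_entry tX P_def)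
  have P0: "P $ i $ j = 0" if "i \<in> -I" for i j
    using that by (simp add: P_def I_def pad_mult_outside)
  have reindex: "(\<Sum>i\<in>I. g i) = (\<Sum>k<m. g (e k))" for g :: "'n \<Rightarrow> real"
    using inj by (simp add: I_def sum.reindex)
  have corner: "(\<Sum>i\<in>I. \<Sum>j\<in>I. (P $ i $ j + P $ j $ i)\<^sup>2) \<le> c * (\<Sum>i\<in>I. \<Sum>j\<in>I. (X $ i $ j)\<^sup>2)"
    using bound[of "\<lambda>k l. X $ e k $ e l"] symX
    by (simp add: reindex L[symmetric] lyapunov_pad_entry[OF inj])
  have column: "2 * (\<Sum>i\<in>I. (P $ i $ j)\<^sup>2) \<le> c * (\<Sum>i\<in>I. (X $ i $ j)\<^sup>2)" for j
    using rank_one_bound[of m a c "\<lambda>l. X $ e l $ j", OF bound]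
    by (simp add: reindex P_def pad_mult_entry[OF inj])
  have "(norm (lyapunov (pad m e a) X))\<^sup>2 =
      (\<Sum>i\<in>I. \<Sum>j\<in>I. (P $ i $ j + P $ j $ i)\<^sup>2) + (\<Sum>j\<in>-I. 2 * (\<Sum>i\<in>I. (P $ i $ j)\<^sup>2))"
    unfolding power2_norm_matrix L split by (simp add: P0 sum_distrib_left[symmetric])
  also have "\<dots> \<le> c * (\<Sum>i\<in>I. \<Sum>j\<in>I. (X $ i $ j)\<^sup>2) + (\<Sum>j\<in>-I. c * (\<Sum>i\<in>I. (X $ i $ j)\<^sup>2))"
    by (intro add_mono sum_mono corner column)
  also have "\<dots> \<le> c * (norm X)\<^sup>2"
    unfolding power2_norm_matrix split sum_distrib_left[symmetric] distrib_left[symmetric]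
    using \<open>0 \<le> c\<close> by (intro mult_left_mono) (simp_all add: sum_nonneg)
  finally show ?thesis .
qed

lemma norm_pad:
  fixes e :: "nat \<Rightarrow> 'n::finite"
  assumes "inj_on e {..<m}"
  shows "(norm (pad m e w))\<^sup>2 = (\<Sum>k<m. \<Sum>l<m. (w k l)\<^sup>2)"
  unfolding power2_norm_matrix
  by (simp add: sum_UNIV_supported[OF assms] pad_outside pad_entry[OF assms])

lemma norm_lyapunov_pad_ge:
  fixes e :: "nat \<Rightarrow> 'n::finite"
  assumes inj: "inj_on e {..<m}"
  shows "(\<Sum>k<m. \<Sum>l<m. (lyap_entry m a w k l)\<^sup>2) \<le> (norm (lyapunov (pad m e a) (pad m e w)))\<^sup>2"
proof -
  let ?L = "lyapunov (pad m e a) (pad m e w)"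
  have entry: "lyap_entry m a w k l = ?L $ e k $ e l" if "k < m" "l < m" for k l
    using that inj by (simp add: lyapunov_pad_entry pad_entry lyap_entry_def)
  have "(\<Sum>k<m. \<Sum>l<m. (lyap_entry m a w k l)\<^sup>2) = (\<Sum>i\<in>e ` {..<m}. \<Sum>j\<in>e ` {..<m}. (?L $ i $ j)\<^sup>2)"
    using inj by (simp add: sum.reindex entry)
  also have "\<dots> \<le> (\<Sum>i\<in>UNIV. \<Sum>j\<in>UNIV. (?L $ i $ j)\<^sup>2)"
    by (rule order_trans[OF sum_mono sum_mono2]) (auto intro!: sum_mono2 sum_nonneg)
  finally show ?thesis by (simp add: power2_norm_matrix)
qed

lemma pad_skew:
  assumes "inj_on e {..<m}" "\<And>k l. k < m \<Longrightarrow> l < m \<Longrightarrow> w k l = - w l k"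
  shows "pad m e w \<in> skew_matrices"
  using assms(1) by (auto simp: skew_matrices_def transpose_def pad_def vec_eq_iff intro: assms(2))

section \<open>The coupled chains\<close>

definition table :: "real list list \<Rightarrow> nat \<Rightarrow> nat \<Rightarrow> real" where
  "table r k l = r ! k ! l"

text \<open>Column \<open>l\<close> is the image of \<open>e\<^sub>l\<close>. The entries 3 in row 0 and -1 in row 2 are the couplings between
  the chain on the indices 0, 1, 2 and the chain on 3, 4, 5, 6.\<close>

definition chains :: "nat \<Rightarrow> nat \<Rightarrow> real" where
  "chains = table
    [[ 0, 0,  0,  3,  0,  0, 0],
     [20, 0,  0,  0,  0,  0, 0],
     [ 0, 3, 14,  0,  0, -1, 0],
     [ 0, 0,  0, 13,  0,  0, 0],
     [ 0, 0,  0,  5,  0,  0, 0],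
     [ 0, 0,  0,  0, 17,  0, 0],
     [ 0, 0,  0,  0,  0, 16, 0]]"

text \<open>A rounded multiple of the top singular vector of \<open>L\<^sub>A\<close> on skew matrices; its large entries lie
  in the off-diagonal block with rows 0, 1, 2 and columns 3, 4, 5, 6.\<close>

definition skew_witness :: "nat \<Rightarrow> nat \<Rightarrow> real" where
  "skew_witness = table
    [[  0,   0,  -5,  3,  2, 23, 1],
     [  0,   0,  -2,  3, 14,  2, 0],
     [  5,   2,   0, 11,  6,  5, 2],
     [ -3,  -3, -11,  0,  2,  3, 3],
     [ -2, -14,  -6, -2,  0,  1, 0],
     [-23,  -2,  -5, -3, -1,  0, 0],
     [ -1,   0,  -2, -3,  0,  0, 0]]"

lemma skew_witness_skew:
  assumes "k < 7" "l < 7"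
  shows "skew_witness k l = - skew_witness l k"
proof -
  have "\<forall>k\<in>{..<7}. \<forall>l\<in>{..<7}. skew_witness k l = - skew_witness l k"
    by (simp add: eval_nat_numeral lessThan_Suc skew_witness_def table_def)
  with assms show ?thesis by blast
qed

lemma sum_lessThan_7: "(\<Sum>k<7. f k) = f 0 + f 1 + f 2 + f 3 + f 4 + f 5 + f (6::nat)"
  for f :: "nat \<Rightarrow> real"
  by (simp add: eval_nat_numeral)

lemma skew_gain:
  "877 * (\<Sum>k<7. \<Sum>l<7. (skew_witness k l)\<^sup>2) < (\<Sum>k<7. \<Sum>l<7. (lyap_entry 7 chains skew_witness k l)\<^sup>2)"
  by (simp add: sum_lessThan_7 lyap_entry_def chains_def skew_witness_def table_def)

section \<open>The symmetric bound\<close>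

text \<open>One step of a Gaussian elimination with rounded numbers: \<open>t\<close> is the variable being eliminated, \<open>m\<close>
  its remaining diagonal coefficient, and \<open>s\<close> the linear form of the variables coupled to it. Exact
  elimination would use \<open>w = 20000\<^sup>2 / m\<close>; rounding \<open>w\<close> up to an integer keeps the form nonnegative. The
  scale 20000 is fine enough for the rounding errors to stay below the gap between 877 and the
  true maximum.\<close>

definition pivot :: "real \<Rightarrow> real \<Rightarrow> real \<Rightarrow> real \<Rightarrow> real" where
  "pivot m t w s = m * t\<^sup>2 + 40000 * (t * s) + w * s\<^sup>2"

lemma pivot_nonneg:
  assumes "0 < m" "20000\<^sup>2 \<le> m * w"
  shows "0 \<le> pivot m t w s"
proof -
  have "m * pivot m t w s = (m * t + 20000 * s)\<^sup>2 + (m * w - 20000\<^sup>2) * s\<^sup>2"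
    by (simp add: pivot_def power2_eq_square algebra_simps)
  also have "\<dots> \<ge> 0" using assms by simp
  finally show ?thesis using assms(1) by (simp add: zero_le_mult_iff)
qed

text \<open>The difference of the two sides is positive definite (the true maximum of the quotient is about
  874.7), and the proof displays it as a sum of nonnegative forms.\<close>

lemma sym_bound:
  assumes sym: "\<And>k l. x k l = x l k"
  shows "(\<Sum>k<7. \<Sum>l<7. (lyap_entry 7 chains x k l)\<^sup>2) \<le> 877 * (\<Sum>k<7. \<Sum>l<7. (x k l)\<^sup>2)"
    (is "?F \<le> 877 * ?q")
proof -
  have upper: "x 1 0 = x 0 1" "x 2 0 = x 0 2" "x 3 0 = x 0 3" "x 4 0 = x 0 4" "x 5 0 = x 0 5" "x 6 0 = x 0 6"
    "x 2 1 = x 1 2" "x 3 1 = x 1 3" "x 4 1 = x 1 4" "x 5 1 = x 1 5" "x 6 1 = x 1 6"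
    "x 3 2 = x 2 3" "x 4 2 = x 2 4" "x 5 2 = x 2 5" "x 6 2 = x 2 6"
    "x 4 3 = x 3 4" "x 5 3 = x 3 5" "x 6 3 = x 3 6" "x 5 4 = x 4 5" "x 6 4 = x 4 6" "x 6 5 = x 5 6"
    by (rule sym)+
  \<comment> \<open>Each square is one entry of \<open>AX + XA\<^sup>T\<close> on or above the diagonal; the factor 2 accounts for
    its mirror image.\<close>
  have F: "?F =
     (6 * x 0 3)\<^sup>2 +
     2 * (20 * x 0 0 + 3 * x 1 3)\<^sup>2 +
     2 * (3 * x 0 1 + 14 * x 0 2 + 3 * x 2 3 - x 0 5)\<^sup>2 +
     2 * (3 * x 3 3 + 13 * x 0 3)\<^sup>2 +
     2 * (3 * x 3 4 + 5 * x 0 3)\<^sup>2 +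
     2 * (3 * x 3 5 + 17 * x 0 4)\<^sup>2 +
     2 * (3 * x 3 6 + 16 * x 0 5)\<^sup>2 +
     (40 * x 0 1)\<^sup>2 +
     2 * (20 * x 0 2 + 3 * x 1 1 + 14 * x 1 2 - x 1 5)\<^sup>2 +
     2 * (20 * x 0 3 + 13 * x 1 3)\<^sup>2 +
     2 * (20 * x 0 4 + 5 * x 1 3)\<^sup>2 +
     2 * (20 * x 0 5 + 17 * x 1 4)\<^sup>2 +
     2 * (20 * x 0 6 + 16 * x 1 5)\<^sup>2 +
     (6 * x 1 2 + 28 * x 2 2 - 2 * x 2 5)\<^sup>2 +
     2 * (3 * x 1 3 + 27 * x 2 3 - x 3 5)\<^sup>2 +
     2 * (3 * x 1 4 + 14 * x 2 4 + 5 * x 2 3 - x 4 5)\<^sup>2 +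
     2 * (3 * x 1 5 + 14 * x 2 5 + 17 * x 2 4 - x 5 5)\<^sup>2 +
     2 * (3 * x 1 6 + 14 * x 2 6 - x 5 6 + 16 * x 2 5)\<^sup>2 +
     (26 * x 3 3)\<^sup>2 +
     2 * (13 * x 3 4 + 5 * x 3 3)\<^sup>2 +
     2 * (13 * x 3 5 + 17 * x 3 4)\<^sup>2 +
     2 * (13 * x 3 6 + 16 * x 3 5)\<^sup>2 +
     (10 * x 3 4)\<^sup>2 +
     2 * (5 * x 3 5 + 17 * x 4 4)\<^sup>2 +
     2 * (5 * x 3 6 + 16 * x 4 5)\<^sup>2 +
     (34 * x 4 5)\<^sup>2 +
     2 * (17 * x 4 6 + 16 * x 5 5)\<^sup>2 +
     (32 * x 5 6)\<^sup>2"
    by (simp add: sum_lessThan_7 lyap_entry_def chains_def table_def upper upper[unfolded One_nat_def]) algebra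
  have q: "?q =
     (x 0 0)\<^sup>2 + (x 1 1)\<^sup>2 + (x 2 2)\<^sup>2 + (x 3 3)\<^sup>2 + (x 4 4)\<^sup>2 + (x 5 5)\<^sup>2 + (x 6 6)\<^sup>2 +
     2 * ((x 0 1)\<^sup>2 + (x 0 2)\<^sup>2 + (x 0 3)\<^sup>2 + (x 0 4)\<^sup>2 + (x 0 5)\<^sup>2 +
       (x 0 6)\<^sup>2 + (x 1 2)\<^sup>2 + (x 1 3)\<^sup>2 + (x 1 4)\<^sup>2 + (x 1 5)\<^sup>2 +
       (x 1 6)\<^sup>2 + (x 2 3)\<^sup>2 + (x 2 4)\<^sup>2 + (x 2 5)\<^sup>2 + (x 2 6)\<^sup>2 +
       (x 3 4)\<^sup>2 + (x 3 5)\<^sup>2 + (x 3 6)\<^sup>2 + (x 4 5)\<^sup>2 + (x 4 6)\<^sup>2 +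
       (x 5 6)\<^sup>2)"
    by (simp add: sum_lessThan_7 upper upper[unfolded One_nat_def])
  \<comment> \<open>The variables are eliminated in an order in which each is coupled to at most four of the later
    ones. In every \<open>pivot\<close> the coefficients of \<open>s\<close> are rounded to integers; the squares of
    two-term sums and differences at the end pay for these roundings, and the diagonal
    coefficients of the pivots are reduced accordingly.\<close>
  have "20000 * (877 * ?q - ?F) =
    17540000 * (x 6 6)\<^sup>2 +
     pivot 1540000 (x 0 0) 260 (- 120 * x 1 3) +
     pivot 19080000 (x 0 6) 21 (- 640 * x 1 5) +
     pivot 5980000 (x 4 4) 67 (- 170 * x 3 5) +
     pivot 23520000 (x 4 6) 18 (- 544 * x 5 5) +
     pivot 7520000 (x 0 4) 54 (- 200 * x 1 3 - 102 * x 3 5) +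
     pivot 1860000 (x 2 2) 216 (- 168 * x 1 2 + 56 * x 2 5) +
     pivot 2660000 (x 3 3) 151 (- 78 * x 0 3 - 130 * x 3 4) +
     pivot 9672456 (x 0 3) 42 (- 107 * x 3 4 - 520 * x 1 3) +
     pivot 11355262 (x 3 4) 36 (- 117 * x 1 3 - 442 * x 3 5) +
     pivot 8839972 (x 1 3) 46 (- 142 * x 3 5 - 162 * x 2 3) +
     pivot 6216116 (x 3 5) 65 (- 416 * x 3 6 + x 2 3) +
     pivot 2720000 (x 0 1) 148 (- 84 * x 0 2 + 6 * x 0 5 - 18 * x 2 3) +
     pivot 17180000 (x 1 1) 24 (- 84 * x 1 2 + 6 * x 1 5 - 120 * x 0 2) +
     pivot 20236576 (x 1 2) 20 (29 * x 1 5 + 114 * x 2 5 - 572 * x 0 2) +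
     pivot 34720000 (x 1 6) 12 (- 84 * x 2 6 + 6 * x 5 6 - 96 * x 2 5) +
     pivot 27146048 (x 2 6) 15 (28 * x 5 6 - 453 * x 2 5) +
     pivot 14538932 (x 5 6) 28 (42 * x 2 5) +
     pivot 15704320 (x 3 6) 26 (- 96 * x 0 5 + x 2 3 - 160 * x 4 5) +
     pivot 1933152 (x 5 5) 207 (6 * x 1 5 + 28 * x 2 5 + 34 * x 2 4) +
     pivot 15793196 (x 1 5) 26 (- 89 * x 2 5 + 57 * x 0 2 - 104 * x 2 4) +
     pivot 12355301 (x 2 5) 33 (72 * x 0 2 - 498 * x 2 4) +
     pivot 3024176 (x 0 2) 133 (32 * x 0 5 - 95 * x 2 3 + 67 * x 2 4) +
     pivot 8404864 (x 0 5) 48 (- 680 * x 1 4 + 27 * x 2 3 - 14 * x 2 4 - 20 * x 4 5) +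
     pivot 953280 (x 1 4) 420 (14 * x 2 3 - 107 * x 2 4 - 27 * x 4 5) +
     pivot 1955393 (x 2 3) 205 (- 65 * x 2 4 + 19 * x 4 5) +
     pivot 666380 (x 2 4) 601 (- 21 * x 4 5) +
     326939 * (x 4 5)\<^sup>2 +
     8860 * (x 0 3 + x 3 4)\<^sup>2 +
     3120 * (x 3 4 + x 1 3)\<^sup>2 +
     3304 * (x 1 3 - x 3 5)\<^sup>2 +
     1816 * (x 3 5 + x 2 3)\<^sup>2 +
     7904 * (x 1 2 - x 1 5)\<^sup>2 +
     7872 * (x 1 2 - x 2 5)\<^sup>2 +
     1920 * (x 1 2 - x 0 2)\<^sup>2 +
     6048 * (x 2 6 + x 5 6)\<^sup>2 +
     3232 * (x 2 6 + x 2 5)\<^sup>2 +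
     2828 * (x 5 6 - x 2 5)\<^sup>2 +
     7040 * (x 3 6 + x 2 3)\<^sup>2 +
     896 * (x 1 5 - x 2 5)\<^sup>2 +
     9040 * (x 1 5 + x 0 2)\<^sup>2 +
     2228 * (x 1 5 - x 2 4)\<^sup>2 +
     3942 * (x 2 5 - x 0 2)\<^sup>2 +
     2280 * (x 2 5 + x 2 4)\<^sup>2 +
     5408 * (x 0 2 - x 0 5)\<^sup>2 +
     3776 * (x 0 2 - x 2 3)\<^sup>2 +
     2624 * (x 0 2 - x 2 4)\<^sup>2 +
     2800 * (x 0 5 + x 2 3)\<^sup>2 +
     5152 * (x 0 5 - x 2 4)\<^sup>2 +
     640 * (x 0 5 + x 4 5)\<^sup>2 +
     1280 * (x 1 4 + x 2 3)\<^sup>2 +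
     3040 * (x 1 4 + x 2 4)\<^sup>2 +
     7200 * (x 1 4 + x 4 5)\<^sup>2 +
     6151 * (x 2 3 - x 2 4)\<^sup>2 +
     8840 * (x 2 3 + x 4 5)\<^sup>2 +
     6355 * (x 2 4 + x 4 5)\<^sup>2"
    (is "_ = ?certificate")
    unfolding F q pivot_def by algebra
  moreover have "0 \<le> ?certificate"
    by (intro add_nonneg_nonneg mult_nonneg_nonneg zero_le_power2 pivot_nonneg) simp_all
  ultimately show ?thesis by simp
qed

section \<open>Restricted norms\<close>

lemma restr_norm_le_sqrt:
  assumes "linear L" "subspace U" "U \<noteq> {0}"
    and bound: "\<And>X. X \<in> U \<Longrightarrow> (norm (L X))\<^sup>2 \<le> c * (norm X)\<^sup>2"
  shows "restr_norm L U \<le> sqrt c"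
proof -
  obtain X where X: "X \<in> U - {0}" "restr_norm L U = norm (L X) / norm X"
    using restr_norm_attained[OF assms(1-3)] by (auto simp: frob_norm_eq_norm)
  have "(norm (L X) / norm X)\<^sup>2 \<le> c"
    using bound[of X] X(1) by (simp add: power_divide divide_le_eq)
  then show ?thesis
    by (simp add: X(2) real_le_rsqrt)
qed

lemma sqrt_less_restr_norm:
  assumes "linear L" "subspace U" "W \<in> U" and gain: "c * (norm W)\<^sup>2 < (norm (L W))\<^sup>2"
  shows "sqrt c < restr_norm L U"
proof -
  have W: "W \<noteq> 0" using gain linear_0[OF assms(1)] by auto
  with assms(3) have "U \<noteq> {0}" by auto
  then have "norm (L W) / norm W \<le> restr_norm L U"
    using restr_norm_attained[OF assms(1,2)] W assms(3) by (auto simp: frob_norm_eq_norm)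
  moreover have "c < (norm (L W) / norm W)\<^sup>2"
    using gain W by (simp add: power_divide less_divide_eq)
  then have "sqrt c < norm (L W) / norm W"
    by (intro real_less_lsqrt) simp_all
  ultimately show ?thesis by simp
qed

theorem corollary4:
  assumes "CARD('n::finite) \<ge> 7"
  shows "\<not> symmetric_maximizer_conjecture TYPE('n) \<and>
    (\<exists>A :: real^'n^'n.
       restr_norm (lyapunov A) skew_matrices > restr_norm (lyapunov A) sym_matrices)"
proof -
  obtain e :: "nat \<Rightarrow> 'n" where "bij_betw e {0..<CARD('n)} UNIV"
    using ex_bij_betw_nat_finite[of "UNIV :: 'n set"] by auto
  then have e: "inj_on e {..<7}"
    using assms by (auto simp: bij_betw_def intro: inj_on_subset)
  define A where "A = pad 7 e chains"
  define W where "W = pad 7 e skew_witness"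
  have "(mat 1 :: real^'n^'n) \<in> sym_matrices" "(mat 1 :: real^'n^'n) \<noteq> 0"
    by (simp_all add: sym_matrices_def transpose_mat) (simp add: mat_def vec_eq_iff)
  then have nontrivial: "(sym_matrices :: (real^'n^'n) set) \<noteq> {0}" by blast
  have "restr_norm (lyapunov A) sym_matrices \<le> sqrt 877"
    unfolding A_def
    by (intro restr_norm_le_sqrt linear_lyapunov subspace_sym_matrices nontrivial
        norm_lyapunov_pad_sym_le e sym_bound) auto
  also have "sqrt 877 < restr_norm (lyapunov A) skew_matrices"
  proof (rule sqrt_less_restr_norm[OF linear_lyapunov subspace_skew_matrices])
    show "W \<in> skew_matrices"
      unfolding W_def by (rule pad_skew[OF e skew_witness_skew])
    show "877 * (norm W)\<^sup>2 < (norm (lyapunov A W))\<^sup>2"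
      using skew_gain norm_lyapunov_pad_ge[OF e, of chains skew_witness]
      by (simp add: A_def W_def norm_pad[OF e])
  qed
  finally have "restr_norm (lyapunov A) sym_matrices < restr_norm (lyapunov A) skew_matrices" .
  then show ?thesis
    unfolding symmetric_maximizer_conjecture_def by (meson not_le)
qed

end
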